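(* Consider the leader-follower game described in the context. Suppose that: Upper level: (i) the leader's payoff function $f(x,\boldsymbol{y})$ is continuous with respect to $(x,\boldsymbol{y})\in X\times\prod_{i=1}^I Y_i$; (ii) the leader's strategy space $X$ is a non-empty, compact set. Lower level: (i) for each $i\in N$ and any $x\in X$ and $y_{-i}\in Y_{-i}$, the payoff function $\varphi_i(x,y_{-i},y_i)$ of follower $i$ is convex (in $y_i$), and $\varphi_i$ is continuous with respect to $(x,y_{-i},y_i)\in X\times\prod_{i=1}^I Y_i$; (ii) for any $i\in N$, $\mu_i(x)$ is continuous with respect to $x\in X$, and the constant $b_i>0$; (iii) for any $i\in N$, $Y_i$ is a non-empty, compact, and convex set that contains the origin. Then the set-valued map $B:X\times\prod_{i=1}^I Y_i\rightrightarrows\prod_{i=1}^I Y_i$ (the best response of all followers, defined in the context) has the following properties: (i) $B$ is non-empty on $X\times\prod_{i=1}^I Y_i$, i.e. $B(x,\boldsymbol{y})\neq\emptyset$ for all $(x,\boldsymbol{y})$; (ii) for any $x\in X$ and $\boldsymbol{y}\in\prod_{i=1}^I Y_i$, $B(x,\boldsymbol{y})$ is a convex set; (iii) for any $x\in X$ and $\boldsymbol{y}\in\prod_{i=1}^I Y_i$, $B(x,\boldsymbol{y})$ is a compact set; (iv) $B$ is upper semicontinuous with respect to $(x,\boldsymbol{y})$.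
   Context: There is one leader with strategy $x\in X\subseteq\mathbb{R}^m$ and payoff $f:X\times\prod_{i=1}^I Y_i\to\mathbb{R}$, and followers $i\in N=\{1,\dots,I\}$ with strategies $y_i\in Y_i\subseteq\mathbb{R}$ and payoffs $\varphi_i:X\times Y_{-i}\times Y_i\to\mathbb{R}$ (to be minimized). Here $\boldsymbol{y}=(y_1,\dots,y_I)$, $y_{-i}=(y_1,\dots,y_{i-1},y_{i+1},\dots,y_I)$ and $Y_{-i}=\prod_{j\ne i}Y_j$. For each $i$: $\mu_i(\cdot):X\to\mathbb{R}$ is a function, $\Sigma_i\ge0$ is a constant (the variance of a finite sample of real numbers), $b_i$ is a constant, $\gamma_{i,1}>0$ and $\gamma_{i,2}>1$ are parameters, $\alpha_i\in(0,1)$, and $$l_i=\begin{cases}\sqrt{\gamma_{i,1}}+\sqrt{\left(\frac{1-\alpha_i}{\alpha_i}\right)\left(\gamma_{i,2}-\gamma_{i,1}\right)}, & \text{when } \gamma_{i,1}/\gamma_{i,2}\le\alpha_i,\\ \sqrt{\gamma_{i,2}/\alpha_i}, & \text{when } \gamma_{i,1}/\gamma_{i,2}>\alpha_i.\end{cases}$$ The follower's strategy space is the set-valued map $S_{F,i}:X\rightrightarrows Y_i$, $$S_{F,i}(x)=\left\{y_i\in Y_i:\ \mu_i(x)y_i+l_i\sqrt{\Sigma_i y_i^2}\le b_i\right\}.$$ The best response of follower $i$ is $H_i:X\times Y_{-i}\rightrightarrows Y_i$, $$H_i(x,y_{-i})=\left\{y_i\in S_{F,i}(x):\ \varphi_i(x,y_{-i},y_i)\le\varphi_i(x,y_{-i},y_i^1)\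 \ \forall y_i^1\in S_{F,i}(x)\right\},$$ and the best response of all followers is $B(x,\boldsymbol{y})=\prod_{i=1}^I H_i(x,y_{-i})$. A set-valued map $G$ with values in a compact set is upper semicontinuous at $z$ if whenever $z_j\to z$, $w_j\in G(z_j)$ for all $j$ and $w_j\to w$, then $w\in G(z)$. *)

theory Defs
  imports "HOL-Analysis.Analysis"
begin

text \<open>
  The followers are the elements of the finite index type \<open>'i\<close>; a joint strategy is a vector
  \<open>y :: real ^ 'i\<close>. A strategy profile of the opponents of \<open>i\<close> is an extensional
  function on \<open>- {i}\<close>, so it carries no information about the strategy of \<open>i\<close>.
  Its topology is the product topology on \<open>'i \<Rightarrow> real\<close>, which on extensional functions is the
  Euclidean topology of the remaining coordinates.
\<close>

definition profiles :: "('i::finite \<Rightarrow> real set) \<Rightarrow> (real ^ 'i) set" where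
  "profiles Y = {y. \<forall>i. y $ i \<in> Y i}"

definition opp_profiles :: "('i \<Rightarrow> real set) \<Rightarrow> 'i \<Rightarrow> ('i \<Rightarrow> real) set" where
  "opp_profiles Y i = (\<Pi>\<^sub>E j\<in>- {i}. Y j)"

definition opp :: "'i::finite \<Rightarrow> real ^ 'i \<Rightarrow> ('i \<Rightarrow> real)" where
  "opp i y = (\<lambda>j\<in>- {i}. y $ j)"

definition risk_coeff :: "real \<Rightarrow> real \<Rightarrow> real \<Rightarrow> real" where
  "risk_coeff \<gamma>1 \<gamma>2 \<alpha> =
    (if \<gamma>1 / \<gamma>2 \<le> \<alpha>
     then sqrt \<gamma>1 + sqrt ((1 - \<alpha>) / \<alpha> * (\<gamma>2 - \<gamma>1))
     else sqrt (\<gamma>2 / \<alpha>))"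

definition follower_strategies ::
    "real set \<Rightarrow> ('a \<Rightarrow> real) \<Rightarrow> real \<Rightarrow> real \<Rightarrow> real \<Rightarrow> 'a \<Rightarrow> real set" where
  "follower_strategies Y \<mu> l \<sigma>2 b x = {y \<in> Y. \<mu> x * y + l * sqrt (\<sigma>2 * y\<^sup>2) \<le> b}"

text \<open>Payoffs of the followers are minimized.\<close>

definition best_response ::
    "('a \<Rightarrow> real set) \<Rightarrow> ('a \<Rightarrow> 'b \<Rightarrow> real \<Rightarrow> real) \<Rightarrow> 'a \<Rightarrow> 'b \<Rightarrow> real set" where
  "best_response S \<phi> x u = {y \<in> S x. \<forall>y1 \<in> S x. \<phi> x u y \<le> \<phi> x u y1}"

definition joint_best_response ::
    "('i::finite \<Rightarrow> 'a \<Rightarrow> real set) \<Rightarrow> ('i \<Rightarrow> 'a \<Rightarrow> ('i \<Rightarrow> real) \<Rightarrow> real \<Rightarrow> real)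
      \<Rightarrow> 'a \<Rightarrow> real ^ 'i \<Rightarrow> (real ^ 'i) set" where
  "joint_best_response S \<phi> x y = {z. \<forall>i. z $ i \<in> best_response (S i) (\<phi> i) x (opp i y)}"

text \<open>
  Upper semicontinuity, at a point \<open>z\<close> of the domain \<open>D\<close>, of a set-valued map whose values
  lie in a common compact set. The latter is understood, not part of the definition; for
  the joint best response it is lemma \<open>joint_best_response_subset\<close> below.
\<close>

definition usc_at :: "'a::topological_space set \<Rightarrow> ('a \<Rightarrow> 'b::topological_space set) \<Rightarrow> 'a \<Rightarrow> bool" where
  "usc_at D G z \<longleftrightarrow>
    (\<forall>zs ws w. (\<forall>j::nat. zs j \<in> D) \<and> zs \<longlonglongrightarrow> z \<and> (\<forall>j. ws j \<in> G (zs j)) \<and> ws \<longlonglongrightarrow> w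
       \<longrightarrow> w \<in> G z)"

lemma joint_best_response_subset:
  assumes "\<And>i. S i x \<subseteq> Y i"
  shows "joint_best_response S \<phi> x y \<subseteq> profiles Y"
  using assms by (auto simp: joint_best_response_def best_response_def profiles_def)

end

theory Submission
  imports Defs
begin

text \<open>
  Follower by follower, the best response is the set of minimizers of a continuous convex
  function over a compact convex set, which contains \<open>0\<close> because \<open>0 \<in> Y\<close> and \<open>0 \<le> b\<close>. Such a set of
  minimizers is nonempty, convex and compact, and these properties pass to the product over the
  followers. The constraint set is convex because the coefficient \<open>l\<close> of the convex term
  \<open>sqrt (\<sigma>2 * y\<^sup>2)\<close> is nonnegative.

  Upper semicontinuity is the closed-graph form of Berge's maximum theorem
  (\<open>best_response_closed_graph\<close>). Let \<open>w\<^sub>j\<close> be a best response to \<open>(x\<^sub>j, u\<^sub>j)\<close>, with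
  \<open>(x\<^sub>j, u\<^sub>j) \<longlonglongrightarrow> (x, u)\<close> and \<open>w\<^sub>j \<longlonglongrightarrow> w\<close>. The limit \<open>w\<close> is feasible at \<open>x\<close> because the constraint is
  a weak inequality between continuous functions. To compare \<open>w\<close> with a feasible strategy \<open>v\<close> at
  \<open>x\<close>, one needs strategies \<open>v\<^sub>j\<close>, feasible at \<open>x\<^sub>j\<close>, with \<open>v\<^sub>j \<longlonglongrightarrow> v\<close>; then
  \<open>\<phi> x\<^sub>j u\<^sub>j w\<^sub>j \<le> \<phi> x\<^sub>j u\<^sub>j v\<^sub>j\<close> passes to the limit.

  The existence of these \<open>v\<^sub>j\<close> (\<open>follower_strategies_recovery_sequence\<close>) is where strictness of
  \<open>b > 0\<close> enters. The loss \<open>h x y = \<mu> x * y + l * sqrt (\<sigma>2 * y\<^sup>2)\<close> is positively homogeneous in \<open>y\<close>,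
  so shrinking \<open>v\<close> towards the origin by the factor \<open>b / max b (h x\<^sub>j v)\<close> makes it feasible at
  \<open>x\<^sub>j\<close>, and this factor tends to \<open>1\<close> since \<open>h x v \<le> b\<close>.
\<close>

section \<open>Products of strategy sets\<close>

lemma joint_best_response_eq_profiles:
  "joint_best_response S \<phi> x y = profiles (\<lambda>i. best_response (S i) (\<phi> i) x (opp i y))"
  by (simp add: joint_best_response_def profiles_def)

lemma profiles_nonempty:
  assumes "\<And>i. K i \<noteq> {}"
  shows "profiles K \<noteq> {}"
proof -
  have "(\<chi> i. SOME t. t \<in> K i) \<in> profiles K"
    using assms by (simp add: profiles_def some_in_eq)
  then show ?thesis by blast
qed

lemma convex_profiles:
  assumes "\<And>i. convex (K i)"
  shows "convex (profiles K)"
  using assms by (auto simp: convex_def profiles_def)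

lemma compact_profiles:
  assumes "\<And>i. compact (K i)"
  shows "compact (profiles K)"
proof -
  have "closed (profiles K)"
    unfolding profiles_def
    by (intro closed_Collect_all closed_vimage_vec_nth[unfolded vimage_def] compact_imp_closed assms)
  moreover have "bounded (profiles K)"
  proof -
    have "\<exists>c. \<forall>i. \<forall>t\<in>K i. norm t \<le> c i"
      using compact_imp_bounded[OF assms] unfolding bounded_iff by metis
    then obtain c where c: "\<And>i t. t \<in> K i \<Longrightarrow> \<bar>t\<bar> \<le> c i"
      by auto
    have "norm y \<le> (\<Sum>i\<in>UNIV. c i)" if "y \<in> profiles K" for y
      using that by (intro order_trans[OF norm_le_l1_cart] sum_mono c) (simp add: profiles_def)
    then show ?thesis
      unfolding bounded_iff by blast
  qed
  ultimately show ?thesis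
    by (simp add: compact_eq_bounded_closed)
qed

lemma opp_in_opp_profiles:
  assumes "y \<in> profiles Y"
  shows "opp i y \<in> opp_profiles Y i"
  using assms by (auto simp: opp_def opp_profiles_def profiles_def)

lemma continuous_on_opp: "continuous_on A (opp i)"
proof (rule continuous_on_coordinatewise_then_product)
  fix j
  show "continuous_on A (\<lambda>y. opp i y j)"
    by (cases "j = i") (auto simp: opp_def intro!: continuous_intros)
qed

section \<open>Best responses as sets of minimizers\<close>

lemma best_response_nonempty_compact:
  fixes S :: "'a \<Rightarrow> real set"
  assumes "compact (S x)" and "S x \<noteq> {}" and "continuous_on (S x) (\<phi> x u)"
  shows "best_response S \<phi> x u \<noteq> {}" and "compact (best_response S \<phi> x u)"
proof -
  obtain m where m: "m \<in> S x" "\<And>y. y \<in> S x \<Longrightarrow> \<phi> x u m \<le> \<phi> x u y"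
    using continuous_attains_inf[OF assms] by blast
  then show "best_response S \<phi> x u \<noteq> {}"
    by (auto simp: best_response_def)
  have eq: "best_response S \<phi> x u = S x \<inter> (S x \<inter> \<phi> x u -` {..\<phi> x u m})"
    using m by (fastforce simp: best_response_def)
  show "compact (best_response S \<phi> x u)"
    unfolding eq
    by (rule compact_Int_closed[OF assms(1)])
      (intro continuous_closed_preimage assms compact_imp_closed closed_atMost)
qed

lemma convex_best_response:
  assumes "convex_on (S x) (\<phi> x u)"
  shows "convex (best_response S \<phi> x u)"
  unfolding convex_def
proof (intro ballI allI impI)
  fix y z and p q :: real
  assume y: "y \<in> best_response S \<phi> x u" and z: "z \<in> best_response S \<phi> x u"
    and pq: "p \<ge> 0" "q \<ge> 0" "p + q = 1"
  have mem: "y \<in> S x" "z \<in> S x"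
    using y z by (auto simp: best_response_def)
  have "\<phi> x u (p *\<^sub>R y + q *\<^sub>R z) \<le> \<phi> x u t" if "t \<in> S x" for t
  proof -
    have "\<phi> x u (p *\<^sub>R y + q *\<^sub>R z) \<le> p * \<phi> x u y + q * \<phi> x u z"
      using assms mem pq by (auto simp: convex_on_def)
    also have "\<dots> \<le> p * \<phi> x u t + q * \<phi> x u t"
      using y z that pq by (intro add_mono mult_left_mono) (auto simp: best_response_def)
    also have "\<dots> = \<phi> x u t"
      using pq(3) by (metis distrib_right mult_1)
    finally show ?thesis .
  qed
  moreover have "p *\<^sub>R y + q *\<^sub>R z \<in> S x"
    using assms mem pq by (auto simp: convex_on_def convex_def)
  ultimately show "p *\<^sub>R y + q *\<^sub>R z \<in> best_response S \<phi> x u"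
    by (auto simp: best_response_def)
qed

text \<open>
  Berge's argument, with the continuity of the feasibility map \<open>S\<close> reduced to its use at the
  given sequences: \<open>feasible\<close> is what a closed graph of \<open>S\<close> provides, and \<open>recovery\<close> is sequential
  lower semicontinuity of \<open>S\<close>. The latter turns optimality against competitors at \<open>xs j\<close> into
  optimality against competitors at \<open>x\<close>.
\<close>

lemma best_response_closed_graph:
  fixes \<phi> :: "'a::topological_space \<Rightarrow> 'b::topological_space \<Rightarrow> real \<Rightarrow> real"
  assumes cont: "continuous_on (X \<times> U \<times> Y) (\<lambda>(x, u, t). \<phi> x u t)"
    and S_sub: "\<And>x. S x \<subseteq> Y"
    and xs: "\<And>j::nat. xs j \<in> X" "xs \<longlonglongrightarrow> x" "x \<in> X"
    and us: "\<And>j. us j \<in> U" "us \<longlonglongrightarrow> u" "u \<in> U"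
    and ws: "\<And>j. ws j \<in> best_response S \<phi> (xs j) (us j)" "ws \<longlonglongrightarrow> w"
    and feasible: "w \<in> S x"
    and recovery: "\<And>v. v \<in> S x \<Longrightarrow> \<exists>vs. (\<forall>j. vs j \<in> S (xs j)) \<and> vs \<longlonglongrightarrow> v"
  shows "w \<in> best_response S \<phi> x u"
proof -
  have lim: "(\<lambda>j. \<phi> (xs j) (us j) (ts j)) \<longlonglongrightarrow> \<phi> x u t"
    if "\<And>j. ts j \<in> S (xs j)" "ts \<longlonglongrightarrow> t" "t \<in> S x" for ts t
  proof -
    have "(\<lambda>j. (xs j, us j, ts j)) \<longlonglongrightarrow> (x, u, t)"
      by (intro tendsto_Pair xs us that)
    moreover have "\<forall>\<^sub>F j in sequentially. (xs j, us j, ts j) \<in> X \<times> U \<times> Y"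
      using xs(1) us(1) that(1) S_sub by (intro always_eventually) blast
    moreover have "(x, u, t) \<in> X \<times> U \<times> Y"
      using xs(3) us(3) that(3) S_sub by auto
    ultimately show ?thesis
      using continuous_on_tendsto_compose[OF cont] by fastforce
  qed
  have ws_S: "ws j \<in> S (xs j)" for j
    using ws(1) by (auto simp: best_response_def)
  have "\<phi> x u w \<le> \<phi> x u v" if v: "v \<in> S x" for v
  proof -
    obtain vs where vs: "\<And>j. vs j \<in> S (xs j)" "vs \<longlonglongrightarrow> v"
      using recovery[OF v] by blast
    have "\<phi> (xs j) (us j) (ws j) \<le> \<phi> (xs j) (us j) (vs j)" for j
      using ws(1)[of j] vs(1)[of j] by (auto simp: best_response_def)
    then show ?thesis
      using lim[OF ws_S ws(2) feasible] lim[OF vs v] by (intro LIMSEQ_le) auto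
  qed
  then show ?thesis
    using feasible by (auto simp: best_response_def)
qed

section \<open>The constraint set of a follower\<close>

lemma risk_coeff_nonneg:
  assumes "0 < \<gamma>1" and "0 < \<gamma>2" and "0 < \<alpha>" and "\<alpha> \<le> 1"
  shows "risk_coeff \<gamma>1 \<gamma>2 \<alpha> \<ge> 0"
proof (cases "\<gamma>1 / \<gamma>2 \<le> \<alpha>")
  case True
  \<comment> \<open>\<open>sqrt\<close> is negative on negative numbers, so the sign of \<open>\<gamma>2 - \<gamma>1\<close> matters.\<close>
  have "\<gamma>1 / \<gamma>2 \<le> 1"
    using True assms by linarith
  then have "\<gamma>1 \<le> \<gamma>2"
    using assms by simp
  then show ?thesis
    using True assms by (simp add: risk_coeff_def)
next
  case False
  then show ?thesis
    using assms by (simp add: risk_coeff_def)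
qed

lemma compact_follower_strategies:
  assumes "compact Y"
  shows "compact (follower_strategies Y \<mu> l \<sigma>2 b x)"
proof -
  have "closed {y::real. \<mu> x * y + l * sqrt (\<sigma>2 * y\<^sup>2) \<le> b}"
    by (intro closed_Collect_le continuous_intros)
  then have "compact (Y \<inter> {y. \<mu> x * y + l * sqrt (\<sigma>2 * y\<^sup>2) \<le> b})"
    by (rule compact_Int_closed[OF assms])
  then show ?thesis
    by (simp add: follower_strategies_def Collect_conj_eq)
qed

text \<open>
  Since \<open>sqrt (\<sigma>2 * y\<^sup>2) = sqrt \<sigma>2 * \<bar>y\<bar>\<close>, the constraint is a sublevel condition on a linear function
  plus a nonnegative multiple of the absolute value.
\<close>

lemma convex_follower_strategies:
  assumes "convex Y" and "l \<ge> 0" and "\<sigma>2 \<ge> 0"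
  shows "convex (follower_strategies Y \<mu> l \<sigma>2 b x)"
  unfolding convex_def
proof (intro ballI allI impI)
  let ?c = "l * sqrt \<sigma>2"
  have sqrt_eq: "l * sqrt (\<sigma>2 * t\<^sup>2) = ?c * \<bar>t\<bar>" for t
    by (simp add: real_sqrt_mult)
  fix y z and p q :: real
  assume y: "y \<in> follower_strategies Y \<mu> l \<sigma>2 b x"
    and z: "z \<in> follower_strategies Y \<mu> l \<sigma>2 b x"
    and pq: "p \<ge> 0" "q \<ge> 0" "p + q = 1"
  have "\<bar>p * y + q * z\<bar> \<le> p * \<bar>y\<bar> + q * \<bar>z\<bar>"
    using abs_triangle_ineq[of "p * y" "q * z"] pq by (simp add: abs_mult)
  then have "?c * \<bar>p * y + q * z\<bar> \<le> ?c * (p * \<bar>y\<bar> + q * \<bar>z\<bar>)"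
    using assms by (intro mult_left_mono) auto
  then have "\<mu> x * (p * y + q * z) + ?c * \<bar>p * y + q * z\<bar>
      \<le> p * (\<mu> x * y + ?c * \<bar>y\<bar>) + q * (\<mu> x * z + ?c * \<bar>z\<bar>)"
    by (simp add: algebra_simps)
  also have "\<dots> \<le> p * b + q * b"
    using y z pq by (intro add_mono mult_left_mono) (auto simp: follower_strategies_def sqrt_eq)
  also have "\<dots> = b"
    using pq(3) by (metis distrib_right mult_1)
  finally show "p *\<^sub>R y + q *\<^sub>R z \<in> follower_strategies Y \<mu> l \<sigma>2 b x"
    using y z pq assms(1) by (auto simp: follower_strategies_def sqrt_eq convex_def)
qed

lemma follower_strategies_closed_graph:
  fixes \<mu> :: "'a::topological_space \<Rightarrow> real"
  assumes "continuous_on X \<mu>" and "closed Y"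
    and xs: "\<And>j::nat. xs j \<in> X" "xs \<longlonglongrightarrow> x" "x \<in> X"
    and ws: "\<And>j. ws j \<in> follower_strategies Y \<mu> l \<sigma>2 b (xs j)" "ws \<longlonglongrightarrow> w"
  shows "w \<in> follower_strategies Y \<mu> l \<sigma>2 b x"
proof -
  have "(\<lambda>j. \<mu> (xs j)) \<longlonglongrightarrow> \<mu> x"
    by (rule continuous_on_tendsto_compose[OF assms(1) xs(2,3)]) (simp add: xs(1))
  then have "(\<lambda>j. \<mu> (xs j) * ws j + l * sqrt (\<sigma>2 * (ws j)\<^sup>2)) \<longlonglongrightarrow> \<mu> x * w + l * sqrt (\<sigma>2 * w\<^sup>2)"
    by (intro tendsto_intros ws)
  then have "\<mu> x * w + l * sqrt (\<sigma>2 * w\<^sup>2) \<le> b"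
    by (rule LIMSEQ_le_const2) (use ws(1) in \<open>auto simp: follower_strategies_def\<close>)
  moreover have "w \<in> Y"
    by (rule closed_sequentially[OF assms(2) _ ws(2)])
      (use ws(1) in \<open>auto simp: follower_strategies_def\<close>)
  ultimately show ?thesis
    by (simp add: follower_strategies_def)
qed

text \<open>
  This is lower semicontinuity of the constraint map. The point \<open>0\<close> satisfies the constraint strictly for
  every \<open>x\<close>, and positive homogeneity of the loss says explicitly how far a strategy must move
  towards it.
\<close>

lemma follower_strategies_recovery_sequence:
  fixes \<mu> :: "'a::topological_space \<Rightarrow> real"
  assumes "continuous_on X \<mu>" and "convex Y" and "0 \<in> Y" and "b > 0"
    and xs: "\<And>j::nat. xs j \<in> X" "xs \<longlonglongrightarrow> x" "x \<in> X"
    and v: "v \<in> follower_strategies Y \<mu> l \<sigma>2 b x"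
  shows "\<exists>vs. (\<forall>j. vs j \<in> follower_strategies Y \<mu> l \<sigma>2 b (xs j)) \<and> vs \<longlonglongrightarrow> v"
proof -
  define h where "h z y = \<mu> z * y + l * sqrt (\<sigma>2 * y\<^sup>2)" for z y
  define s where "s j = b / max b (h (xs j) v)" for j
  have h_scale: "h z (t * y) = t * h z y" if "t \<ge> 0" for t z y
    using that by (simp add: h_def real_sqrt_mult power_mult_distrib algebra_simps)
  have vY: "v \<in> Y" and hv: "h x v \<le> b"
    using v by (auto simp: follower_strategies_def h_def)
  have s: "0 \<le> s j" "s j \<le> 1" for j
    using \<open>b > 0\<close> by (auto simp: s_def)
  have "s j * v \<in> follower_strategies Y \<mu> l \<sigma>2 b (xs j)" for j
  proof -
    have "s j * v \<in> Y"
      using convexD_alt[OF assms(2,3) vY s(1)[of j] s(2)[of j]] by simp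
    moreover have "h (xs j) (s j * v) \<le> b"
    proof -
      have "s j * h (xs j) v \<le> s j * max b (h (xs j) v)"
        using s by (intro mult_left_mono) auto
      also have "\<dots> = b"
        using \<open>b > 0\<close> by (simp add: s_def)
      finally show ?thesis
        using s by (simp add: h_scale)
    qed
    ultimately show ?thesis
      by (simp add: follower_strategies_def h_def)
  qed
  moreover have "(\<lambda>j. s j * v) \<longlonglongrightarrow> v"
  proof -
    have "(\<lambda>j. \<mu> (xs j)) \<longlonglongrightarrow> \<mu> x"
      by (rule continuous_on_tendsto_compose[OF assms(1) xs(2,3)]) (simp add: xs(1))
    then have "(\<lambda>j. h (xs j) v) \<longlonglongrightarrow> h x v"
      unfolding h_def by (intro tendsto_intros)
    then have "(\<lambda>j. s j * v) \<longlonglongrightarrow> b / max b (h x v) * v"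
      unfolding s_def using \<open>b > 0\<close> by (intro tendsto_intros) auto
    moreover have "b / max b (h x v) = 1"
      using hv \<open>b > 0\<close> by (simp add: max_absorb1)
    ultimately show ?thesis by simp
  qed
  ultimately show ?thesis
    by (intro exI[of _ "\<lambda>j. s j * v"]) auto
qed

section \<open>The joint best response\<close>

theorem lemma5:
  fixes X :: "(real ^ 'm) set"
    and Y :: "'i::finite \<Rightarrow> real set"
    and f :: "real ^ 'm \<Rightarrow> real ^ 'i \<Rightarrow> real"
    and \<phi> :: "'i \<Rightarrow> real ^ 'm \<Rightarrow> ('i \<Rightarrow> real) \<Rightarrow> real \<Rightarrow> real"
    and \<mu> :: "'i \<Rightarrow> real ^ 'm \<Rightarrow> real"
    and \<sigma>2 b \<gamma>1 \<gamma>2 \<alpha> :: "'i \<Rightarrow> real"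
  defines "S \<equiv> \<lambda>i. follower_strategies (Y i) (\<mu> i) (risk_coeff (\<gamma>1 i) (\<gamma>2 i) (\<alpha> i)) (\<sigma>2 i) (b i)"
  defines "B \<equiv> joint_best_response S \<phi>"
  assumes "\<And>i. \<sigma>2 i \<ge> 0"
    and "\<And>i. \<gamma>1 i > 0"
    and "\<And>i. \<gamma>2 i > 1"
    and "\<And>i. 0 < \<alpha> i \<and> \<alpha> i < 1"
    and "continuous_on (X \<times> profiles Y) (\<lambda>(x, y). f x y)"
    and "X \<noteq> {}" and "compact X"
    and "\<And>i x u. x \<in> X \<Longrightarrow> u \<in> opp_profiles Y i \<Longrightarrow> convex_on (Y i) (\<phi> i x u)"
    and "\<And>i. continuous_on (X \<times> opp_profiles Y i \<times> Y i) (\<lambda>(x, u, t). \<phi> i x u t)"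
    and "\<And>i. continuous_on X (\<mu> i)"
    and "\<And>i. b i > 0"
    and "\<And>i. Y i \<noteq> {}" and "\<And>i. compact (Y i)" and "\<And>i. convex (Y i)" and "\<And>i. 0 \<in> Y i"
  shows "(\<forall>x\<in>X. \<forall>y\<in>profiles Y. B x y \<noteq> {})
    \<and> (\<forall>x\<in>X. \<forall>y\<in>profiles Y. convex (B x y))
    \<and> (\<forall>x\<in>X. \<forall>y\<in>profiles Y. compact (B x y))
    \<and> (\<forall>z\<in>X \<times> profiles Y. usc_at (X \<times> profiles Y) (\<lambda>(x, y). B x y) z)"
proof -
  note \<sigma>2 = assms(3) and cost_convex = assms(10) and cost_cont = assms(11)
    and \<mu>_cont = assms(12) and b = assms(13)
    and Y_compact = assms(15) and Y_convex = assms(16) and Y_zero = assms(17)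
  have S_sub: "S i x \<subseteq> Y i" for i x
    by (auto simp: S_def follower_strategies_def)
  have S_zero: "0 \<in> S i x" for i x
    using Y_zero[of i] b[of i] by (simp add: S_def follower_strategies_def)
  have S_compact: "compact (S i x)" for i x
    unfolding S_def by (intro compact_follower_strategies Y_compact)
  have l: "risk_coeff (\<gamma>1 i) (\<gamma>2 i) (\<alpha> i) \<ge> 0" for i
    using assms(4)[of i] assms(5)[of i] assms(6)[of i] by (intro risk_coeff_nonneg) auto
  have S_convex: "convex (S i x)" for i x
    unfolding S_def by (intro convex_follower_strategies Y_convex l \<sigma>2)

  have BR: "best_response (S i) (\<phi> i) x (opp i y) \<noteq> {}"
    "compact (best_response (S i) (\<phi> i) x (opp i y))"
    "convex (best_response (S i) (\<phi> i) x (opp i y))"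
    if x: "x \<in> X" and y: "y \<in> profiles Y" for i x y
  proof -
    have u: "opp i y \<in> opp_profiles Y i"
      using y by (rule opp_in_opp_profiles)
    have "continuous_on (S i x) (\<lambda>t. (\<lambda>(x, u, t). \<phi> i x u t) (x, opp i y, t))"
      using x u S_sub
      by (intro continuous_on_compose2[OF cost_cont] continuous_intros) auto
    then have "continuous_on (S i x) (\<phi> i x (opp i y))"
      by simp
    then show "best_response (S i) (\<phi> i) x (opp i y) \<noteq> {}"
      "compact (best_response (S i) (\<phi> i) x (opp i y))"
      using S_zero[of i x] best_response_nonempty_compact[of "S i" x "\<phi> i", OF S_compact]
      by blast+
    show "convex (best_response (S i) (\<phi> i) x (opp i y))"
      by (intro convex_best_response convex_on_subset[OF cost_convex[OF x u]] S_sub S_convex)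
  qed

  have usc: "usc_at (X \<times> profiles Y) (\<lambda>(x, y). B x y) (x, y)"
    if x: "x \<in> X" and y: "y \<in> profiles Y" for x y
    unfolding usc_at_def
  proof (intro allI impI, elim conjE)
    fix zs ws w
    assume "\<forall>j::nat. zs j \<in> X \<times> profiles Y" and zs: "zs \<longlonglongrightarrow> (x, y)"
      and ws: "\<forall>j. ws j \<in> (case zs j of (x, y) \<Rightarrow> B x y)" "ws \<longlonglongrightarrow> w"
    then have dom: "fst (zs j) \<in> X" "snd (zs j) \<in> profiles Y" for j
      by (auto simp: mem_Times_iff)
    have xs_lim: "(\<lambda>j. fst (zs j)) \<longlonglongrightarrow> x" and ys_lim: "(\<lambda>j. snd (zs j)) \<longlonglongrightarrow> y"
      using tendsto_fst[OF zs] tendsto_snd[OF zs] by auto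
    have "w $ i \<in> best_response (S i) (\<phi> i) x (opp i y)" for i
    proof (rule best_response_closed_graph[OF cost_cont S_sub dom(1) xs_lim x])
      show "opp i (snd (zs j)) \<in> opp_profiles Y i" for j
        using dom(2) by (rule opp_in_opp_profiles)
      show "(\<lambda>j. opp i (snd (zs j))) \<longlonglongrightarrow> opp i y"
        by (rule continuous_on_tendsto_compose[OF continuous_on_opp[of UNIV] ys_lim]) auto
      show "opp i y \<in> opp_profiles Y i"
        using y by (rule opp_in_opp_profiles)
      show br: "ws j $ i \<in> best_response (S i) (\<phi> i) (fst (zs j)) (opp i (snd (zs j)))" for j
        using ws(1) by (auto simp: B_def joint_best_response_def split_beta)
      show lim: "(\<lambda>j. ws j $ i) \<longlonglongrightarrow> w $ i"
        using ws(2) by (rule tendsto_vec_nth)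
      have "ws j $ i \<in> S i (fst (zs j))" for j
        using br by (simp add: best_response_def)
      then show "w $ i \<in> S i x"
        unfolding S_def
        by (rule follower_strategies_closed_graph
            [OF \<mu>_cont compact_imp_closed[OF Y_compact] dom(1) xs_lim x _ lim])
      show "\<exists>vs. (\<forall>j. vs j \<in> S i (fst (zs j))) \<and> vs \<longlonglongrightarrow> v" if "v \<in> S i x" for v
        using that unfolding S_def
        by (rule follower_strategies_recovery_sequence
            [OF \<mu>_cont Y_convex Y_zero b dom(1) xs_lim x])
    qed
    then show "w \<in> (case (x, y) of (x, y) \<Rightarrow> B x y)"
      by (simp add: B_def joint_best_response_def)
  qed

  show ?thesis
  proof (intro conjI ballI)
    fix x y assume xy: "x \<in> X" "y \<in> profiles Y"
    show "B x y \<noteq> {}" "convex (B x y)" "compact (B x y)"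
      unfolding B_def joint_best_response_eq_profiles
      by (intro profiles_nonempty convex_profiles compact_profiles BR xy)+
  next
    fix z assume "z \<in> X \<times> profiles Y"
    then show "usc_at (X \<times> profiles Y) (\<lambda>(x, y). B x y) z"
      using usc by auto
  qed
qed

end
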